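(* Let $G$ be a $K_5$-minor-free graph and let $R\subseteq E(G)$ be a neighbouring set of edges. Then $$\mu^{\ast}(G[R])\leq \frac{9}{2}.$$
   Context: Graphs are finite, simple and without loops. A set $R\subseteq E(G)$ is a neighbouring set (in $G$) if for every two edges $e,f\in R$ there exist an endvertex $u$ of $e$ and an endvertex $v$ of $f$ with $d_G(u,v)\leq 1$ (i.e. $u=v$ or $uv\in E(G)$). $G[R]$ denotes the subgraph of $G$ induced by the edges of $R$: its vertices are exactly the endvertices of edges in $R$, and its edges are exactly the edges of $R$. A fractional matching of a graph $H$ is a map $g:E(H)\to\mathbb{R}_{\geq 0}$ such that for every vertex $v$, the sum of $g(e)$ over the edges $e$ incident to $v$ is at most $1$; its value is $\sum_{e\in E(H)}g(e)$, and $\mu^{\ast}(H)$ is the supremum of the values of all fractional matchings of $H$. *)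

theory Defs
  imports Complex_Main "HOL-Library.Extended_Nat" "HOL-Library.Disjoint_Sets"
begin

section \<open>Finite simple graphs\<close>

record 'a ugraph =
  verts :: "'a set"
  edges :: "'a set set"

text \<open>An edge is the two-element set of its endvertices, so there are no loops and no parallel edges.\<close>

locale simple_graph =
  fixes G :: "'a ugraph" (structure)
  assumes finite_verts: "finite (verts G)"
    and edge_verts: "e \<in> edges G \<Longrightarrow> e \<subseteq> verts G"
    and card_edge: "e \<in> edges G \<Longrightarrow> card e = 2"

definition complete_graph :: "nat \<Rightarrow> nat ugraph" where
  "complete_graph n = \<lparr>verts = {..<n}, edges = {e. e \<subseteq> {..<n} \<and> card e = 2}\<rparr>"

definition induced_subgraph :: "'a ugraph \<Rightarrow> 'a set \<Rightarrow> 'a ugraph" where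
  "induced_subgraph G S = \<lparr>verts = S, edges = {e \<in> edges G. e \<subseteq> S}\<rparr>"

definition edge_induced_subgraph :: "'a set set \<Rightarrow> 'a ugraph" where
  "edge_induced_subgraph R = \<lparr>verts = \<Union>R, edges = R\<rparr>"


section \<open>Walks, distance and connectedness\<close>

text \<open>A walk is its nonempty list of vertices; its length is the number of its edges.\<close>

definition walk :: "'a ugraph \<Rightarrow> 'a \<Rightarrow> 'a list \<Rightarrow> 'a \<Rightarrow> bool" where
  "walk G u p v \<longleftrightarrow> p \<noteq> [] \<and> hd p = u \<and> last p = v \<and> set p \<subseteq> verts G \<and>
     (\<forall>i. Suc i < length p \<longrightarrow> {p ! i, p ! Suc i} \<in> edges G)"

definition walk_length :: "'a list \<Rightarrow> nat" where
  "walk_length p = length p - 1"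

text \<open>The distance is \<open>\<infinity>\<close> for vertices in different components, as the infimum is then over the
  empty set.\<close>

definition graph_dist :: "'a ugraph \<Rightarrow> 'a \<Rightarrow> 'a \<Rightarrow> enat" where
  "graph_dist G u v = (INF p \<in> {p. walk G u p v}. enat (walk_length p))"

definition connected_graph :: "'a ugraph \<Rightarrow> bool" where
  "connected_graph G \<longleftrightarrow> verts G \<noteq> {} \<and> (\<forall>u \<in> verts G. \<forall>v \<in> verts G. \<exists>p. walk G u p v)"


section \<open>Minors\<close>

text \<open>\<open>B x\<close> is the branch set of the vertex \<open>x\<close> of \<open>H\<close>. Contracting every branch set and
  deleting the superfluous vertices and edges of \<open>G\<close> leaves a copy of \<open>H\<close>.\<close>

definition minor_model :: "('b \<Rightarrow> 'a set) \<Rightarrow> 'b ugraph \<Rightarrow> 'a ugraph \<Rightarrow> bool" where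
  "minor_model B H G \<longleftrightarrow>
     (\<forall>x \<in> verts H. B x \<subseteq> verts G \<and> connected_graph (induced_subgraph G (B x))) \<and>
     disjoint_family_on B (verts H) \<and>
     (\<forall>x y. {x, y} \<in> edges H \<longrightarrow> (\<exists>u \<in> B x. \<exists>v \<in> B y. {u, v} \<in> edges G))"

definition is_minor :: "'b ugraph \<Rightarrow> 'a ugraph \<Rightarrow> bool" where
  "is_minor H G \<longleftrightarrow> (\<exists>B. minor_model B H G)"


section \<open>Neighbouring sets and fractional matchings\<close>

definition neighbouring_set :: "'a ugraph \<Rightarrow> 'a set set \<Rightarrow> bool" where
  "neighbouring_set G R \<longleftrightarrow> R \<subseteq> edges G \<and>
     (\<forall>e \<in> R. \<forall>f \<in> R. \<exists>u \<in> e. \<exists>v \<in> f. graph_dist G u v \<le> 1)"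

text \<open>The values of \<open>g\<close> outside \<open>edges H\<close> are irrelevant.\<close>

definition fractional_matching :: "'a ugraph \<Rightarrow> ('a set \<Rightarrow> real) \<Rightarrow> bool" where
  "fractional_matching H g \<longleftrightarrow>
     (\<forall>e \<in> edges H. 0 \<le> g e) \<and>
     (\<forall>v \<in> verts H. (\<Sum>e \<in> {e \<in> edges H. v \<in> e}. g e) \<le> 1)"

definition fractional_matching_value :: "'a ugraph \<Rightarrow> ('a set \<Rightarrow> real) \<Rightarrow> real" where
  "fractional_matching_value H g = (\<Sum>e \<in> edges H. g e)"

definition fractional_matching_number :: "'a ugraph \<Rightarrow> real" where
  "fractional_matching_number H =
     (SUP g \<in> {g. fractional_matching H g}. fractional_matching_value H g)"


section \<open>Sanity checks\<close>

lemma (in simple_graph) finite_edges: "finite (edges G)"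
  by (rule finite_subset[of _ "Pow (verts G)"]) (use edge_verts finite_verts in auto)

lemma simple_graph_complete_graph: "simple_graph (complete_graph n)"
  by unfold_locales (auto simp: complete_graph_def)

lemma (in simple_graph) simple_graph_edge_induced_subgraph:
  assumes "R \<subseteq> edges G"
  shows "simple_graph (edge_induced_subgraph R)"
proof
  show "finite (verts (edge_induced_subgraph R))"
    using assms edge_verts
    by (auto simp: edge_induced_subgraph_def intro: finite_subset[OF _ finite_verts])
qed (use assms card_edge in \<open>auto simp: edge_induced_subgraph_def\<close>)

lemma (in simple_graph) graph_dist_le_1_iff:
  assumes "u \<in> verts G" "v \<in> verts G"
  shows "graph_dist G u v \<le> 1 \<longleftrightarrow> u = v \<or> {u, v} \<in> edges G"
proof
  assume le: "graph_dist G u v \<le> 1"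
  have ne: "{p. walk G u p v} \<noteq> {}"
    using le by (force simp: graph_dist_def top_enat_def)
  then have "graph_dist G u v \<in> (\<lambda>p. enat (walk_length p)) ` {p. walk G u p v}"
    unfolding graph_dist_def Inf_enat_def by (auto intro: LeastI)
  then obtain p where p: "walk G u p v" "walk_length p \<le> 1"
    using le by (auto simp: one_enat_def)
  show "u = v \<or> {u, v} \<in> edges G"
  proof (cases p)
    case (Cons a q)
    with p show ?thesis
      by (cases q) (auto simp: walk_def walk_length_def)
  qed (use p in \<open>simp add: walk_def\<close>)
next
  assume r: "u = v \<or> {u, v} \<in> edges G"
  have "\<exists>p. walk G u p v \<and> walk_length p \<le> 1"
  proof (cases "u = v")
    case True
    then have "walk G u [u] v \<and> walk_length [u] \<le> 1"
      using assms by (simp add: walk_def walk_length_def)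
    then show ?thesis by blast
  next
    case False
    then have "walk G u [u, v] v \<and> walk_length [u, v] \<le> 1"
      using assms r by (simp add: walk_def walk_length_def)
    then show ?thesis by blast
  qed
  then obtain p where "walk G u p v" "walk_length p \<le> 1" by blast
  then show "graph_dist G u v \<le> 1"
    unfolding graph_dist_def by (intro INF_lower2[of p]) (auto simp: one_enat_def)
qed

lemma fractional_matching_zero: "fractional_matching H (\<lambda>_. 0)"
  by (simp add: fractional_matching_def)

text \<open>The supremum of reals in \<open>fractional_matching_number\<close> is over a set that is nonempty and
  bounded above.\<close>

lemma (in simple_graph) bdd_above_fractional_matching_value:
  "bdd_above (fractional_matching_value G ` {g. fractional_matching G g})"
proof (rule bdd_aboveI2)
  fix g assume "g \<in> {g. fractional_matching G g}"
  then have g: "fractional_matching G g" by simp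
  have "g e \<le> 1" if e: "e \<in> edges G" for e
  proof -
    obtain v where v: "v \<in> e" using card_edge[OF e] by fastforce
    have "g e \<le> (\<Sum>e \<in> {e \<in> edges G. v \<in> e}. g e)"
      by (rule member_le_sum) (use g e v finite_edges in \<open>auto simp: fractional_matching_def\<close>)
    also have "\<dots> \<le> 1"
      using g v edge_verts[OF e] by (auto simp: fractional_matching_def)
    finally show ?thesis .
  qed
  then show "fractional_matching_value G g \<le> real (card (edges G))"
    unfolding fractional_matching_value_def using sum_bounded_above[of "edges G" g 1] by simp
qed

end

theory Submission
  imports Defs
begin

text \<open>
  Suppose that some fractional matching has value more than \<open>9/2\<close>. Then every vertex cover of the
  bipartite double cover of \<open>G[R]\<close> has at least ten vertices, by weak duality
  (\<open>fractional_matching_value_le\<close>), so the double cover has a matching of size ten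
  (\<open>koenig\<close>). Read as a set of directed edges in \<open>G[R]\<close>, this matching consists of disjoint
  directed paths and cycles, and it yields vertex-disjoint edges and cycles of \<open>G[R]\<close> that have at
  least ten vertices in total (\<open>packing_of_partial_injection\<close>). This is the half-integrality of
  fractional matchings in the form needed here.

  An even cycle can be replaced by a perfect matching of it, and an odd cycle by a matching that leaves
  out one of its vertices. Parity makes it possible to keep ten vertices until there are no odd cycles
  left or exactly two (\<open>no_odd_cycles_and_edges\<close>).

  Call a connected set of vertices full if it contains an edge of \<open>R\<close>. Since \<open>R\<close> is a
  neighbouring set, two disjoint full sets are joined by an edge, so five disjoint full sets are the
  branch sets of a \<open>K\<^sub>5\<close>-minor. This excludes five disjoint edges. If two odd cycles remain and their
  matchings and the other edges do not make five edges, then there are exactly ten vertices, and the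
  pieces are two pentagons, or a triangle and a heptagon, or a triangle, a pentagon and an edge, or two
  triangles and two edges. In the first case a vertex with two neighbours on the other pentagon gives a
  minor, and without such vertices two adjacent vertices of one pentagon cannot reach all the edges of
  the other. In the other cases the key is that three full sets disjoint from a triangle and from each
  other have to miss its three vertices one by one, since a vertex seen by all three would be a branch
  set itself (\<open>three_full_sets_miss_triangle\<close>).
\<close>

section \<open>Koenig's theorem for a finite relation\<close>

text \<open>A relation is the edge set of a bipartite graph, its two arguments ranging over the two sides.
  The finiteness of \<open>A\<close> and \<open>B\<close> makes their cardinalities meaningful.\<close>

definition rel_cover :: "('a \<times> 'b) set \<Rightarrow> 'a set \<Rightarrow> 'b set \<Rightarrow> bool" where
  "rel_cover E A B \<longleftrightarrow> finite A \<and> finite B \<and> (\<forall>(u, v) \<in> E. u \<in> A \<or> v \<in> B)"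

lemma rel_cover_converse: "rel_cover (E\<inverse>) B A \<longleftrightarrow> rel_cover E A B"
  by (auto simp: rel_cover_def)

text \<open>The deletion of any edge of \<open>E\<close> makes a cover with fewer than \<open>n\<close> vertices possible, and then no
  two edges \<open>(x, y)\<close> and \<open>(x, z)\<close> share their left end (the argument is due to Lovasz). Take
  small covers \<open>(A, B)\<close> and \<open>(A', B')\<close> of what remains without the one and without the other edge.
  Neither \<open>A\<close> nor \<open>A'\<close> contains \<open>x\<close>, as the cover would then cover \<open>E\<close>; so \<open>y \<in> B'\<close> and \<open>z \<in> B\<close>. Crossing them gives
  \<open>(A \<inter> A', B \<union> B')\<close>, which covers \<open>E\<close>, and \<open>(A \<union> A', B \<inter> B')\<close>, which covers all
  but the two edges and needs only the extra vertex \<open>x\<close>. By submodularity the two crossed covers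
  have at most \<open>2 (n - 1) + 1\<close> vertices together, so one of them has fewer than \<open>n\<close>.\<close>

lemma critical_inj_on_fst:
  fixes E :: "('a \<times> 'b) set"
  assumes lower: "\<And>A B. rel_cover E A B \<Longrightarrow> n \<le> card A + card B"
    and critical: "\<And>e. e \<in> E \<Longrightarrow> \<exists>A B. rel_cover (E - {e}) A B \<and> card A + card B < n"
  shows "inj_on fst E"
proof (rule inj_onI, rule ccontr)
  fix e e' assume e: "e \<in> E" "e' \<in> E" "fst e = fst e'" "e \<noteq> e'"
  then obtain x y z where xyz: "e = (x, y)" "e' = (x, z)" "y \<noteq> z"
    by (metis prod.collapse prod_eq_iff)
  obtain A B where AB: "rel_cover (E - {e}) A B" "card A + card B < n"
    using critical e by blast
  obtain A' B' where AB': "rel_cover (E - {e'}) A' B'" "card A' + card B' < n"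
    using critical e by blast
  have fin: "finite A" "finite B" "finite A'" "finite B'"
    using AB AB' by (auto simp: rel_cover_def)
  have "x \<notin> A"
  proof
    assume "x \<in> A"
    with AB have "rel_cover E A B" by (auto simp: rel_cover_def xyz)
    with lower AB show False by fastforce
  qed
  moreover have "x \<notin> A'"
  proof
    assume "x \<in> A'"
    with AB' have "rel_cover E A' B'" by (auto simp: rel_cover_def xyz)
    with lower AB' show False by fastforce
  qed
  ultimately have yz: "y \<in> B'" "z \<in> B"
    using AB AB' e xyz by (auto simp: rel_cover_def)
  have "rel_cover E (A \<inter> A') (B \<union> B')"
    using AB(1) AB'(1) yz xyz by (fastforce simp: rel_cover_def)
  then have 1: "n \<le> card (A \<inter> A') + card (B \<union> B')" by (rule lower)
  have "rel_cover E (insert x (A \<union> A')) (B \<inter> B')"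
    using AB(1) AB'(1) yz xyz by (fastforce simp: rel_cover_def)
  then have 2: "n \<le> card (insert x (A \<union> A')) + card (B \<inter> B')" by (rule lower)
  have "card (insert x (A \<union> A')) \<le> Suc (card (A \<union> A'))"
    by (rule card_insert_le_m1) auto
  with 1 2 AB(2) AB'(2) card_Un_Int[OF fin(1,3)] card_Un_Int[OF fin(2,4)]
  show False by linarith
qed

text \<open>Delete edges as long as the lower bound on covers survives. What is left is critical on both
  sides, hence it is a matching itself, and its left ends already form a cover.\<close>

lemma koenig:
  fixes E :: "('a \<times> 'b) set"
  assumes "finite E"
    and "\<And>A B. rel_cover E A B \<Longrightarrow> n \<le> card A + card B"
  obtains M where "M \<subseteq> E" "inj_on fst M" "inj_on snd M" "n \<le> card M"
proof -
  have "\<exists>M \<subseteq> E. inj_on fst M \<and> inj_on snd M \<and> n \<le> card M"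
    using assms
  proof (induction E rule: finite_psubset_induct)
    case (psubset E)
    show ?case
    proof (cases "\<exists>e \<in> E. \<forall>A B. rel_cover (E - {e}) A B \<longrightarrow> n \<le> card A + card B")
      case True
      then obtain e where "e \<in> E" "\<And>A B. rel_cover (E - {e}) A B \<Longrightarrow> n \<le> card A + card B"
        by blast
      with psubset.IH[of "E - {e}"] show ?thesis by blast
    next
      case False
      then have crit: "\<exists>A B. rel_cover (E - {e}) A B \<and> card A + card B < n" if "e \<in> E" for e
        using that by (meson not_le)
      have 1: "inj_on fst E"
        using psubset.prems crit by (rule critical_inj_on_fst)
      have "inj_on fst (E\<inverse>)"
      proof (rule critical_inj_on_fst)
        show "n \<le> card A + card B" if "rel_cover (E\<inverse>) A B" for A B
          using psubset.prems[of B A] that by (simp add: rel_cover_converse)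
        fix e assume "e \<in> E\<inverse>"
        then have e: "prod.swap e \<in> E" and eq: "E\<inverse> - {e} = (E - {prod.swap e})\<inverse>" by auto
        from crit[OF e] show "\<exists>A B. rel_cover (E\<inverse> - {e}) A B \<and> card A + card B < n"
          unfolding eq rel_cover_converse by (metis add.commute)
      qed
      then have 2: "inj_on snd E"
        unfolding inj_on_def by (metis converse_iff fst_conv prod.collapse snd_conv)
      have "rel_cover E (fst ` E) {}"
        using psubset.hyps by (force simp: rel_cover_def)
      from psubset.prems[OF this] have "n \<le> card E"
        using card_image_le[OF psubset.hyps, of fst] by simp
      with 1 2 show ?thesis by blast
    qed
  qed
  with that show ?thesis by blast
qed

section \<open>Disjoint cycles and edges from a partial injection\<close>

text \<open>A list of two vertices counts as a cycle when they form an edge. Single edges and cycles are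
  thus the same kind of piece.\<close>

definition cycle_in :: "'a set set \<Rightarrow> 'a list \<Rightarrow> bool" where
  "cycle_in R c \<longleftrightarrow> distinct c \<and> 2 \<le> length c \<and> successively (\<lambda>u v. {u, v} \<in> R) c \<and>
     {last c, hd c} \<in> R"

definition packing :: "'a set set \<Rightarrow> 'a list list \<Rightarrow> bool" where
  "packing R cs \<longleftrightarrow> (\<forall>c \<in> set cs. cycle_in R c) \<and> distinct (concat cs)"

text \<open>The last vertex of a longest path has its successor on the path, and injectivity leaves only the
  first vertex for it.\<close>

lemma closed_path_exists:
  assumes "finite M" "M \<noteq> {}" "snd ` M \<subseteq> fst ` M" "inj_on snd M"
  obtains c where "c \<noteq> []" "distinct c" "successively (\<lambda>u v. (u, v) \<in> M) c" "(last c, hd c) \<in> M"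
proof -
  let ?P = "\<lambda>c. c \<noteq> [] \<and> set c \<subseteq> fst ` M \<and> distinct c \<and> successively (\<lambda>u v. (u, v) \<in> M) c"
  obtain x y where xy: "(x, y) \<in> M" using assms(2) by fastforce
  have "?P [x]" using xy by force
  moreover have "length c \<le> card (fst ` M)" if "?P c" for c
    using that assms(1) card_mono[of "fst ` M" "set c"] distinct_card[of c] by simp
  ultimately have "\<exists>c. ?P c \<and> (\<forall>d. ?P d \<longrightarrow> length d \<le> length c)"
    by (intro ex_has_greatest_nat[of ?P "[x]" length "Suc (card (fst ` M))"])
      (simp_all add: less_Suc_eq_le)
  then obtain c where c: "?P c" and max: "\<And>d. ?P d \<Longrightarrow> length d \<le> length c"
    by blast
  obtain y where y: "(last c, y) \<in> M" using c last_in_set by fastforce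
  have "y \<in> set c"
  proof (rule ccontr)
    assume "y \<notin> set c"
    moreover have "y \<in> fst ` M" using y assms(3) by force
    ultimately have "?P (c @ [y])" using c y by (auto simp: successively_append_iff)
    from max[OF this] show False by simp
  qed
  then obtain p q where pq: "c = p @ y # q" by (auto simp: in_set_conv_decomp)
  have "p = []"
  proof (rule ccontr)
    assume "p \<noteq> []"
    with c pq have "(last p, y) \<in> M" by (auto simp: successively_append_iff)
    with y assms(4) have "last p = last c" by (metis Pair_inject inj_onD snd_conv)
    moreover have "last c \<in> set (y # q)" using pq by (metis last_appendR last_in_set list.discI)
    moreover have "last p \<in> set p" using \<open>p \<noteq> []\<close> by simp
    ultimately show False using c pq by auto
  qed
  with pq y have "(last c, hd c) \<in> M" by simp
  with c that show ?thesis by blast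
qed

text \<open>A relation that is injective in both directions is a disjoint union of directed paths and directed
  cycles. An arc \<open>(y, z)\<close> into a sink is split off as an edge: besides it at most the arc into
  \<open>y\<close> is lost, so two vertices pay for at most two arcs. Without a sink there is a directed cycle, and it
  has as many vertices as arcs.\<close>

lemma packing_of_partial_injection:
  assumes "finite M" "inj_on fst M" "inj_on snd M" "\<And>u v. (u, v) \<in> M \<Longrightarrow> {u, v} \<in> R \<and> u \<noteq> v"
  shows "\<exists>cs. packing R cs \<and> set (concat cs) \<subseteq> fst ` M \<union> snd ` M \<and> card M \<le> length (concat cs)"
  using assms
proof (induction M rule: finite_psubset_induct)
  case (psubset M)
  have step: ?case
    if N: "N \<subset> M" "(fst ` N \<union> snd ` N) \<inter> set c = {}" "card M \<le> card N + length c"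
      and c: "cycle_in R c" "set c \<subseteq> fst ` M \<union> snd ` M" for N c
  proof -
    have "\<exists>cs. packing R cs \<and> set (concat cs) \<subseteq> fst ` N \<union> snd ` N \<and> card N \<le> length (concat cs)"
      using N(1) psubset.prems by (intro psubset.IH) (auto intro: inj_on_subset)
    then obtain cs where "packing R cs" "set (concat cs) \<subseteq> fst ` N \<union> snd ` N"
      "card N \<le> length (concat cs)" by blast
    moreover from this have "packing R (c # cs)"
      using c(1) N(2) by (auto simp: packing_def cycle_in_def)
    moreover have "fst ` N \<subseteq> fst ` M" "snd ` N \<subseteq> snd ` M" using N(1) by auto
    ultimately show ?thesis using N(3) c(2)
      by (intro exI[of _ "c # cs"]) (simp, blast)
  qed
  consider "M = {}" | (sink) "\<not> snd ` M \<subseteq> fst ` M" | (closed) "M \<noteq> {}" "snd ` M \<subseteq> fst ` M"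
    by blast
  then show ?case
  proof cases
    case 1
    then show ?thesis by (intro exI[of _ "[]"]) (simp add: packing_def)
  next
    case sink
    then obtain y z where yz: "(y, z) \<in> M" "z \<notin> fst ` M" by force
    define N where "N = {a \<in> M. snd a \<noteq> y} - {(y, z)}"
    have "card {a \<in> M. snd a = y} \<le> 1"
      using psubset.prems(2) psubset.hyps by (auto simp: card_le_Suc0_iff_eq inj_on_def)
    moreover have "M = N \<union> insert (y, z) {a \<in> M. snd a = y}" using yz by (auto simp: N_def)
    then have "card M \<le> card N + card (insert (y, z) {a \<in> M. snd a = y})"
      by (metis card_Un_le)
    moreover have "card (insert (y, z) {a \<in> M. snd a = y}) \<le> Suc (card {a \<in> M. snd a = y})"
      by (rule card_insert_le_m1) auto
    ultimately have card: "card M \<le> card N + length [y, z]" by simp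
    show ?thesis
    proof (rule step[of N "[y, z]"])
      show "N \<subset> M" using yz by (auto simp: N_def)
      have "a = (y, z)" if "a \<in> M" "fst a = y \<or> snd a = z" for a
        using that yz(1) psubset.prems(1,2) by (metis fst_conv snd_conv inj_onD)
      then have "fst a \<noteq> y \<and> snd a \<noteq> y \<and> snd a \<noteq> z" if "a \<in> N" for a
        using that by (simp add: N_def) blast
      moreover have "fst a \<noteq> z" if "a \<in> N" for a
        using that yz(2) by (auto simp: N_def)
      ultimately show "(fst ` N \<union> snd ` N) \<inter> set [y, z] = {}"
        by auto
      show "cycle_in R [y, z]"
        using psubset.prems(3)[OF yz(1)] by (auto simp: cycle_in_def insert_commute)
      show "set [y, z] \<subseteq> fst ` M \<union> snd ` M" using yz by force
    qed (rule card)
  next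
    case closed
    from closed_path_exists[OF psubset.hyps this psubset.prems(2)]
    obtain c where c: "c \<noteq> []" "distinct c" "successively (\<lambda>u v. (u, v) \<in> M) c" "(last c, hd c) \<in> M" .
    have "cycle_in R c"
    proof -
      have "successively (\<lambda>u v. {u, v} \<in> R) c"
        using c(3) psubset.prems(3) by (auto elim: successively_mono)
      moreover have "2 \<le> length c"
        using c psubset.prems(3)[OF c(4)] by (cases c rule: remdups_adj.cases) auto
      ultimately show ?thesis using c psubset.prems(3) by (auto simp: cycle_in_def)
    qed
    have pred: "\<exists>u \<in> set c. (u, v) \<in> M" if v: "v \<in> set c" for v
    proof -
      obtain p q where pq: "c = p @ v # q" using v by (auto simp: in_set_conv_decomp)
      show ?thesis
      proof (cases "p = []")
        case True
        then show ?thesis using pq c(1,4) by (intro bexI[of _ "last c"]) auto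
      next
        case False
        then show ?thesis using pq c(3) by (intro bexI[of _ "last p"]) (auto simp: successively_append_iff)
      qed
    qed
    have succ: "\<exists>w \<in> set c. (u, w) \<in> M" if u: "u \<in> set c" for u
    proof -
      obtain p q where pq: "c = p @ u # q" using u by (auto simp: in_set_conv_decomp)
      show ?thesis
      proof (cases q)
        case Nil
        then have "last c = u" using pq by simp
        with c(1,4) show ?thesis by (intro bexI[of _ "hd c"]) simp_all
      next
        case (Cons w r)
        then show ?thesis using pq c(3) by (intro bexI[of _ w]) (auto simp: successively_append_iff)
      qed
    qed
    define N where "N = {a \<in> M. fst a \<notin> set c}"
    have "card {a \<in> M. fst a \<in> set c} \<le> card (set c)"
      using psubset.prems(1) by (intro card_inj_on_le[of fst]) (auto intro: inj_on_subset)
    moreover have "M = N \<union> {a \<in> M. fst a \<in> set c}" by (auto simp: N_def)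
    then have "card M \<le> card N + card {a \<in> M. fst a \<in> set c}"
      by (metis card_Un_le)
    ultimately have card: "card M \<le> card N + length c"
      using distinct_card[OF c(2)] by simp
    show ?thesis
    proof (rule step[of N c])
      have "(last c, hd c) \<in> M - N" using c(1,4) by (simp add: N_def)
      then show "N \<subset> M" unfolding N_def by blast
      show "(fst ` N \<union> snd ` N) \<inter> set c = {}"
        using pred psubset.prems(2) by (fastforce simp: N_def inj_on_def)
      show "set c \<subseteq> fst ` M \<union> snd ` M" using succ by force
    qed fact+
  qed
qed

fun pairs :: "'a list \<Rightarrow> 'a list list" where
  "pairs (x # y # xs) = [x, y] # pairs xs"
| "pairs _ = []"

lemma concat_pairs: "concat (pairs xs) = take (2 * (length xs div 2)) xs"
  by (induction xs rule: pairs.induct) auto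

lemma length_concat_pairs: "length (concat (pairs xs)) = 2 * (length xs div 2)"
  by (simp add: concat_pairs)

lemma length_pairs: "length (pairs xs) = length xs div 2"
  by (induction xs rule: pairs.induct) auto

lemma set_concat_pairs: "set (concat (pairs xs)) \<subseteq> set xs"
  by (simp add: concat_pairs set_take_subset)

lemma length_of_mem_pairs: "p \<in> set (pairs xs) \<Longrightarrow> length p = 2"
  by (induction xs rule: pairs.induct) auto

lemma packing_pairs:
  assumes "distinct xs" "successively (\<lambda>u v. {u, v} \<in> R) xs"
  shows "packing R (pairs xs)"
proof -
  have "\<forall>p \<in> set (pairs xs). cycle_in R p"
    using assms
    by (induction xs rule: pairs.induct) (auto simp: cycle_in_def insert_commute successively_Cons)
  then show ?thesis
    using assms(1) by (simp add: packing_def concat_pairs)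
qed

lemma packing_append:
  "packing R (cs @ ds) \<longleftrightarrow> packing R cs \<and> packing R ds \<and> set (concat cs) \<inter> set (concat ds) = {}"
  by (auto simp: packing_def)

lemma packing_Cons:
  "packing R (c # cs) \<longleftrightarrow> cycle_in R c \<and> packing R cs \<and> set c \<inter> set (concat cs) = {}"
  by (auto simp: packing_def cycle_in_def)

lemma packing_pairs_of_cycle: "cycle_in R c \<Longrightarrow> packing R (pairs c)"
  by (auto simp: cycle_in_def packing_pairs)

text \<open>A cycle of even length has a perfect matching, so that it can be replaced by edges without losing
  vertices.\<close>

lemma packing_odd_cycles_and_edges:
  assumes "packing R cs"
  shows "\<exists>os ms. packing R (os @ ms) \<and> (\<forall>c \<in> set os. odd (length c)) \<and> (\<forall>c \<in> set ms. length c = 2) \<and>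
    set (concat (os @ ms)) \<subseteq> set (concat cs) \<and> length (concat (os @ ms)) = length (concat cs)"
  using assms
proof (induction cs)
  case Nil
  then show ?case by (intro exI[of _ "[]"]) auto
next
  case (Cons c cs)
  then obtain os ms where IH: "packing R (os @ ms)" "\<forall>c \<in> set os. odd (length c)"
    "\<forall>c \<in> set ms. length c = 2"
    "set (concat (os @ ms)) \<subseteq> set (concat cs)" "length (concat (os @ ms)) = length (concat cs)"
    by (auto simp: packing_Cons)
  have c: "cycle_in R c" "set c \<inter> set (concat cs) = {}"
    using Cons.prems by (auto simp: packing_Cons)
  show ?case
  proof (cases "odd (length c)")
    case True
    have "packing R ((c # os) @ ms)"
      using c IH(1,4) by (simp add: packing_Cons) blast
    then show ?thesis
      using True IH by (intro exI[of _ "c # os"] exI[of _ ms]) auto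
  next
    case False
    have "packing R (os @ pairs c @ ms)"
      using c(2) IH(1,4) packing_pairs_of_cycle[OF c(1)] set_concat_pairs[of c]
      unfolding packing_append concat_append set_append by blast
    moreover have "set (concat (os @ pairs c @ ms)) \<subseteq> set (concat (c # cs))"
      using IH(4) set_concat_pairs[of c] unfolding concat_append concat.simps set_append by blast
    moreover have "length (concat (os @ pairs c @ ms)) = length (concat (c # cs))"
      using IH(5) False length_concat_pairs[of c] by simp
    moreover have "\<forall>p \<in> set (pairs c @ ms). length p = 2"
      using IH(3) length_of_mem_pairs[of _ c] by auto
    ultimately show ?thesis using IH(2) by blast
  qed
qed


section \<open>Connected sets and complete minors\<close>

definition touch :: "'a ugraph \<Rightarrow> 'a set \<Rightarrow> 'a set \<Rightarrow> bool" where
  "touch G S T \<longleftrightarrow> (\<exists>u \<in> S. \<exists>v \<in> T. {u, v} \<in> edges G)"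

definition connected_in :: "'a ugraph \<Rightarrow> 'a set \<Rightarrow> bool" where
  "connected_in G S \<longleftrightarrow> S \<subseteq> verts G \<and> connected_graph (induced_subgraph G S)"

lemma touch_sym: "touch G S T \<longleftrightarrow> touch G T S"
  unfolding touch_def by (metis insert_commute)

lemma touch_mono: "touch G S T \<Longrightarrow> S \<subseteq> S' \<Longrightarrow> T \<subseteq> T' \<Longrightarrow> touch G S' T'"
  by (auto simp: touch_def)

lemma touch_insert_right: "touch G S (insert v T) \<longleftrightarrow> touch G S {v} \<or> touch G S T"
  by (auto simp: touch_def)

lemma walk_mono:
  "walk (induced_subgraph G S) u p v \<Longrightarrow> S \<subseteq> S' \<Longrightarrow> walk (induced_subgraph G S') u p v"
  by (auto simp: walk_def induced_subgraph_def)

lemma walk_append: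
  assumes "walk H u p v" "walk H v' q w" "{v, v'} \<in> edges H"
  shows "walk H u (p @ q) w"
proof -
  have "{(p @ q) ! i, (p @ q) ! Suc i} \<in> edges H" if i: "Suc i < length (p @ q)" for i
  proof -
    consider "Suc i < length p" | "Suc i = length p" | "length p \<le> i" by linarith
    then show ?thesis
    proof cases
      case 2
      then have "p ! i = v" "q ! 0 = v'"
        using assms(1,2) by (auto simp: walk_def last_conv_nth hd_conv_nth simp flip: 2)
      with 2 assms(3) show ?thesis by (simp add: nth_append)
    next
      case 3
      moreover have "Suc (i - length p) < length q" using 3 i by auto
      ultimately show ?thesis
        using assms(2) by (simp add: walk_def nth_append Suc_diff_le)
    qed (use assms(1) in \<open>simp add: walk_def nth_append\<close>)
  qed
  with assms(1,2) show ?thesis by (auto simp: walk_def)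
qed

lemma connected_in_Un:
  assumes "connected_in G S" "connected_in G T" "touch G S T"
  shows "connected_in G (S \<union> T)"
proof -
  obtain s t where st: "s \<in> S" "t \<in> T" "{s, t} \<in> edges G"
    using assms(3) by (auto simp: touch_def)
  let ?H = "induced_subgraph G (S \<union> T)"
  have st': "{s, t} \<in> edges ?H" "{t, s} \<in> edges ?H"
    using st by (auto simp: induced_subgraph_def insert_commute)
  have S: "\<exists>p. walk ?H u p v" if "u \<in> S" "v \<in> S" for u v
  proof -
    have "\<exists>p. walk (induced_subgraph G S) u p v"
      using assms(1) that unfolding connected_in_def connected_graph_def
      by (simp add: induced_subgraph_def)
    then obtain p where "walk (induced_subgraph G S) u p v" by blast
    then have "walk ?H u p v" by (rule walk_mono) simp
    then show ?thesis by blast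
  qed
  have T: "\<exists>p. walk ?H u p v" if "u \<in> T" "v \<in> T" for u v
  proof -
    have "\<exists>p. walk (induced_subgraph G T) u p v"
      using assms(2) that unfolding connected_in_def connected_graph_def
      by (simp add: induced_subgraph_def)
    then obtain p where "walk (induced_subgraph G T) u p v" by blast
    then have "walk ?H u p v" by (rule walk_mono) simp
    then show ?thesis by blast
  qed
  have "\<exists>p. walk ?H u p v" if "u \<in> S \<union> T" "v \<in> S \<union> T" for u v
    using that S T st st' walk_append[of ?H] by (metis Un_iff)
  moreover have "S \<union> T \<noteq> {}" using st by auto
  ultimately show ?thesis
    using assms(1,2) by (auto simp: connected_in_def connected_graph_def induced_subgraph_def)
qed

lemma connected_in_singleton:
  assumes "v \<in> verts G"
  shows "connected_in G {v}"
proof -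
  have "walk (induced_subgraph G {v}) v [v] v"
    by (simp add: walk_def induced_subgraph_def)
  with assms show ?thesis
    by (auto simp: connected_in_def connected_graph_def induced_subgraph_def)
qed

text \<open>The branch sets are given as a list, so that for explicitly listed sets the simplifier reduces the
  condition to the finitely many pairs.\<close>

lemma complete_minorI:
  assumes "\<forall>S \<in> set Bs. connected_in G S"
    and "sorted_wrt (\<lambda>S T. S \<inter> T = {} \<and> touch G S T) Bs"
  shows "is_minor (complete_graph (length Bs)) G"
proof -
  let ?n = "length Bs"
  have pair: "Bs ! i \<inter> Bs ! j = {} \<and> touch G (Bs ! i) (Bs ! j)" if "i < ?n" "j < ?n" "i \<noteq> j" for i j
  proof (cases "i < j")
    case True
    then show ?thesis using assms(2) that by (simp add: sorted_wrt_iff_nth_less)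
  next
    case False
    with that have "j < i" by simp
    then have "Bs ! j \<inter> Bs ! i = {} \<and> touch G (Bs ! j) (Bs ! i)"
      using assms(2) that unfolding sorted_wrt_iff_nth_less by blast
    then show ?thesis using touch_sym[of G] by blast
  qed
  have "minor_model ((!) Bs) (complete_graph ?n) G"
    unfolding minor_model_def
  proof (intro conjI ballI allI impI)
    fix x assume x: "x \<in> verts (complete_graph ?n)"
    with assms(1) have "connected_in G (Bs ! x)" by (simp add: complete_graph_def)
    then show "Bs ! x \<subseteq> verts G" "connected_graph (induced_subgraph G (Bs ! x))"
      by (auto simp: connected_in_def)
  next
    show "disjoint_family_on ((!) Bs) (verts (complete_graph ?n))"
      using pair by (auto simp: disjoint_family_on_def complete_graph_def)
  next
    fix x y assume xy: "{x, y} \<in> edges (complete_graph ?n)"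
    then have "x \<noteq> y" by (auto simp: complete_graph_def)
    with xy have "touch G (Bs ! x) (Bs ! y)"
      using pair by (simp add: complete_graph_def)
    then show "\<exists>u \<in> Bs ! x. \<exists>v \<in> Bs ! y. {u, v} \<in> edges G"
      by (simp add: touch_def)
  qed
  then show ?thesis by (auto simp: is_minor_def)
qed


section \<open>Full sets\<close>

lemma packing_disjoint:
  "packing R cs \<Longrightarrow> sorted_wrt (\<lambda>c d. set c \<inter> set d = {}) cs"
  by (induction cs) (auto simp: packing_Cons)

locale neighbouring_edges = simple_graph G for G :: "'a ugraph" (structure) +
  fixes R :: "'a set set"
  assumes neighbouring: "neighbouring_set G R"
begin

lemma R_edge: "e \<in> R \<Longrightarrow> e \<in> edges G"
  using neighbouring by (auto simp: neighbouring_set_def)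

lemma R_vertex: "{u, v} \<in> R \<Longrightarrow> u \<in> verts G \<and> v \<in> verts G"
  using R_edge edge_verts by fastforce

lemma R_neq: "{u, v} \<in> R \<Longrightarrow> u \<noteq> v"
  using R_edge card_edge by fastforce

text \<open>Disjoint full sets always touch, so they can serve as branch sets at once.\<close>

definition full :: "'a set \<Rightarrow> bool" where
  "full S \<longleftrightarrow> connected_in G S \<and> (\<exists>e \<in> R. e \<subseteq> S)"

lemma full_touch:
  assumes "full S" "full T" "S \<inter> T = {}"
  shows "touch G S T"
proof -
  obtain e f where ef: "e \<in> R" "e \<subseteq> S" "f \<in> R" "f \<subseteq> T"
    using assms(1,2) by (auto simp: full_def)
  with neighbouring obtain u v where uv: "u \<in> e" "v \<in> f" "graph_dist G u v \<le> 1"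
    by (meson neighbouring_set_def)
  have "u \<in> verts G" "v \<in> verts G" using ef uv R_edge edge_verts by blast+
  with uv have "u = v \<or> {u, v} \<in> edges G" by (simp add: graph_dist_le_1_iff)
  with ef uv assms(3) show ?thesis by (auto simp: touch_def)
qed

lemma full_edge: "{u, v} \<in> R \<Longrightarrow> full {u, v}"
  using connected_in_Un[of G "{u}" "{v}"] connected_in_singleton[of u G] connected_in_singleton[of v G]
    R_vertex[of u v] R_edge[of "{u, v}"]
  by (auto simp: full_def touch_def insert_commute)

lemma full_path:
  assumes "{p, q} \<in> R" "{q, r} \<in> R"
  shows "full {p, q, r}"
proof -
  have "connected_in G ({p, q} \<union> {r})"
    using assms R_vertex R_edge
    by (intro connected_in_Un) (auto simp: touch_def connected_in_singleton full_edge[unfolded full_def])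
  moreover have "{p, q} \<union> {r} = {p, q, r}" by auto
  ultimately show ?thesis using assms(1) by (auto simp: full_def)
qed

lemma full_connected_in: "full S \<Longrightarrow> connected_in G S"
  by (simp add: full_def)

end

locale K5_free_neighbouring_edges = neighbouring_edges +
  assumes K5_free: "\<not> is_minor (complete_graph 5) G"
begin

lemma no_five_branch_sets:
  assumes "\<forall>S \<in> {A, B, C, D, E}. connected_in G S"
    and "sorted_wrt (\<lambda>S T. S \<inter> T = {} \<and> touch G S T) [A, B, C, D, E]"
  shows False
  using complete_minorI[of "[A, B, C, D, E]" G] assms K5_free by (simp add: eval_nat_numeral)

lemma no_five_edges:
  assumes "packing R ms" "\<forall>m \<in> set ms. length m = 2" "5 \<le> length ms"
  shows False
proof -
  let ?ms = "take 5 ms"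
  have full: "full (set m)" if "m \<in> set ?ms" for m
  proof -
    have m: "m \<in> set ms" using that by (rule in_set_takeD)
    then have "length m = Suc (Suc 0)" using assms(2) by simp
    then obtain u v where uv: "m = [u, v]" by (auto simp: length_Suc_conv)
    with m assms(1) have "{u, v} \<in> R"
      by (auto simp: packing_def cycle_in_def)
    with uv show ?thesis by (simp add: full_edge)
  qed
  have "packing R ?ms"
    using assms(1) packing_append[of R ?ms "drop 5 ms"] by simp
  then have "sorted_wrt (\<lambda>c d. set c \<inter> set d = {}) ?ms"
    by (rule packing_disjoint)
  then have "sorted_wrt (\<lambda>c d. set c \<inter> set d = {} \<and> touch G (set c) (set d)) ?ms"
    by (rule sorted_wrt_mono_rel[rotated]) (simp add: full full_touch)
  then have "sorted_wrt (\<lambda>S T. S \<inter> T = {} \<and> touch G S T) (map set ?ms)"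
    by (simp add: sorted_wrt_map)
  then have "is_minor (complete_graph (length (map set ?ms))) G"
    using full by (intro complete_minorI) (auto simp: full_connected_in)
  with K5_free assms(3) show False by simp
qed


section \<open>A triangle and three full sets\<close>

text \<open>The cases with a triangle are settled by keeping track of which of its vertices are missed.\<close>

definition missed :: "'a set \<Rightarrow> 'a set \<Rightarrow> 'a set" where
  "missed T S = {w \<in> T. \<not> touch G S {w}}"

definition triangle :: "'a set \<Rightarrow> bool" where
  "triangle T \<longleftrightarrow> card T = 3 \<and> (\<forall>u \<in> T. \<forall>v \<in> T. u \<noteq> v \<longrightarrow> {u, v} \<in> R)"

lemma triangle_edge: "triangle T \<Longrightarrow> u \<in> T \<Longrightarrow> v \<in> T \<Longrightarrow> u \<noteq> v \<Longrightarrow> {u, v} \<in> R"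
  by (simp add: triangle_def)

lemma missed_antimono: "S \<subseteq> S' \<Longrightarrow> missed T S' \<subseteq> missed T S"
  by (auto simp: missed_def dest: touch_mono)

text \<open>Two vertices of a triangle form an edge of \<open>R\<close>, which a full set must touch.\<close>

lemma missed_unique:
  assumes T: "triangle T" and S: "full S" "S \<inter> T = {}" and w: "u \<in> missed T S" "v \<in> missed T S"
  shows "u = v"
proof (rule ccontr)
  assume "u \<noteq> v"
  with T w have "{u, v} \<in> R" by (auto simp: triangle_def missed_def)
  then have "touch G S {u, v}"
    using S w by (intro full_touch full_edge) (auto simp: missed_def)
  then show False using w by (auto simp: missed_def touch_insert_right[of G S u "{v}"])
qed

text \<open>If all three full sets had a neighbour at a vertex \<open>w\<close> of the triangle, then they would give a
  \<open>K\<^sub>5\<close>-minor together with \<open>{w}\<close> and the opposite edge. So the three vertices are all missed,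
  while each full set misses at most one.\<close>

lemma three_full_sets_miss_triangle:
  assumes T: "triangle T"
    and full: "full A" "full B" "full C"
    and disj: "A \<inter> B = {}" "A \<inter> C = {}" "B \<inter> C = {}" "A \<inter> T = {}" "B \<inter> T = {}" "C \<inter> T = {}"
  obtains x y z where "T = {x, y, z}" "x \<noteq> y" "x \<noteq> z" "y \<noteq> z"
    "missed T A = {x}" "missed T B = {y}" "missed T C = {z}"
proof -
  have cover: "w \<in> missed T A \<union> missed T B \<union> missed T C" if w: "w \<in> T" for w
  proof (rule ccontr)
    assume no: "w \<notin> missed T A \<union> missed T B \<union> missed T C"
    have "card (T - {w}) = 2" using T w by (simp add: triangle_def)
    then obtain u v where uv: "T - {w} = {u, v}" "u \<noteq> v" by (auto simp: card_2_iff)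
    then have "{u, v} \<in> R" "{w, u} \<in> R" "u \<noteq> w" "v \<noteq> w" "u \<in> T" "v \<in> T"
      using T w unfolding triangle_def by blast+
    note E = this
    have uvT: "{u, v} \<subseteq> T" using E by simp
    have "w \<notin> A \<and> w \<notin> B \<and> w \<notin> C" using w disj by blast
    moreover
    have "touch G S {u, v} \<and> S \<inter> {u, v} = {}" if "full S" "S \<inter> T = {}" for S
    proof -
      have "S \<inter> {u, v} = {}" using that(2) uvT by blast
      with that(1) E(1) show ?thesis by (simp add: full_touch full_edge)
    qed
    moreover have "touch G {w} {u, v}" using R_edge[OF E(2)] by (auto simp: touch_def)
    ultimately show False
      using no_five_branch_sets[of A B C "{w}" "{u, v}"] full disj E no w R_vertex[OF E(2)]
      by (auto simp: full_edge full_connected_in connected_in_singleton missed_def full_touch)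
  qed
  have sub: "missed T S \<subseteq> T" for S by (auto simp: missed_def)
  have fin: "finite T" and card: "card T = 3"
    using T by (auto simp: triangle_def intro: card_ge_0_finite)
  have le: "card (missed T S) \<le> 1" if "full S" "S \<inter> T = {}" for S
    using missed_unique[OF T that] finite_subset[OF sub fin] by (auto simp: card_le_Suc0_iff_eq)
  have T_eq: "T = missed T A \<union> missed T B \<union> missed T C" using cover sub by blast
  have "3 \<le> card (missed T A) + card (missed T B) + card (missed T C)"
    using card card_Un_le[of "missed T A \<union> missed T B" "missed T C"]
      card_Un_le[of "missed T A" "missed T B"] by (simp flip: T_eq)
  with le[OF full(1) disj(4)] le[OF full(2) disj(5)] le[OF full(3) disj(6)]
  have "card (missed T A) = 1" "card (missed T B) = 1" "card (missed T C) = 1" by linarith+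
  then obtain x y z where xyz: "missed T A = {x}" "missed T B = {y}" "missed T C = {z}"
    by (metis card_1_singletonE)
  then have "T = {x, y, z}" using T_eq by auto
  moreover from this card have "x \<noteq> y" "x \<noteq> z" "y \<noteq> z"
    by (auto simp: card_insert_if split: if_splits)
  ultimately show ?thesis using that xyz by blast
qed

lemma missed_eq_of_subset:
  assumes "triangle T" "full S" "S \<inter> T = {}" "S \<subseteq> S'" "missed T S' = {z}"
  shows "missed T S = {z}"
proof -
  have "z \<in> missed T S" using missed_antimono[OF assms(4), of T] assms(5) by auto
  with missed_unique[OF assms(1-3)] show ?thesis by blast
qed

text \<open>The path on \<open>p, q, r\<close> misses some vertex of the triangle, and its two edges miss at least what
  the path misses, but each of them misses at most one vertex.\<close>

lemma missed_by_path:
  assumes T: "triangle T" and path: "{p, q} \<in> R" "{q, r} \<in> R"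
    and full: "full A" "full B"
    and disj: "A \<inter> B = {}" "A \<inter> {p, q, r} = {}" "B \<inter> {p, q, r} = {}"
      "A \<inter> T = {}" "B \<inter> T = {}" "{p, q, r} \<inter> T = {}"
  shows "missed T {p, q} = missed T {q, r} \<and> missed T {p, q} \<noteq> missed T A \<and> missed T {p, q} \<noteq> missed T B"
proof -
  obtain x y z where xyz: "T = {x, y, z}" "x \<noteq> y" "x \<noteq> z" "y \<noteq> z"
    "missed T A = {x}" "missed T B = {y}" "missed T {p, q, r} = {z}"
    using three_full_sets_miss_triangle[OF T full full_path[OF path]] disj by metis
  have "missed T {p, q} = {z}"
    by (rule missed_eq_of_subset[OF T full_edge[OF path(1)] _ _ xyz(7)]) (use disj in auto)
  moreover have "missed T {q, r} = {z}"
    by (rule missed_eq_of_subset[OF T full_edge[OF path(2)] _ _ xyz(7)]) (use disj in auto)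
  ultimately show ?thesis using xyz by auto
qed

section \<open>Two odd cycles\<close>

lemma triangle_of_cycle: "cycle_in R [x, y, z] \<Longrightarrow> triangle {x, y, z}"
  by (auto simp: cycle_in_def triangle_def insert_commute)

text \<open>With \<open>g\<close> as one full set, every split of the pentagon into an edge and a path yields information.
  Turning the split around the pentagon shows that consecutive edges miss the same vertex of \<open>T\<close>,
  which contradicts that the edge and the path of one split miss different vertices.\<close>

lemma no_triangle_pentagon_edge:
  assumes T: "triangle T" and c: "cycle_in R [a, b, c, d, e]" and g: "full g"
    and disj: "{a, b, c, d, e} \<inter> T = {}" "g \<inter> T = {}" "g \<inter> {a, b, c, d, e} = {}"
  shows False
proof -
  have R: "{a, b} \<in> R" "{b, c} \<in> R" "{c, d} \<in> R" "{d, e} \<in> R" "{e, a} \<in> R"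
    and d: "distinct [a, b, c, d, e]"
    using c by (simp_all add: cycle_in_def)
  have "missed T {c, d} = missed T {d, e} \<and> missed T {c, d} \<noteq> missed T {a, b}"
    using missed_by_path[OF T R(3,4) full_edge[OF R(1)] g] d disj by auto
  moreover have "missed T {d, e} = missed T {e, a}"
    using missed_by_path[OF T R(4,5) full_edge[OF R(2)] g] d disj by auto
  moreover have "missed T {e, a} = missed T {a, b}"
    using missed_by_path[OF T R(5,1) full_edge[OF R(3)] g] d disj by auto
  ultimately show False by simp
qed

text \<open>As for the pentagon, but now each split is into two edges and a path.\<close>

lemma no_triangle_heptagon:
  assumes T: "triangle T" and c: "cycle_in R [a, b, c, d, e, f, g]"
    and disj: "{a, b, c, d, e, f, g} \<inter> T = {}"
  shows False
proof -
  have R: "{a, b} \<in> R" "{b, c} \<in> R" "{c, d} \<in> R" "{d, e} \<in> R" "{e, f} \<in> R" "{f, g} \<in> R" "{g, a} \<in> R"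
    and d: "distinct [a, b, c, d, e, f, g]"
    using c by (simp_all add: cycle_in_def)
  have "missed T {e, f} = missed T {f, g} \<and> missed T {e, f} \<noteq> missed T {a, b}"
    using missed_by_path[OF T R(5,6) full_edge[OF R(1)] full_edge[OF R(3)]] d disj by auto
  moreover have "missed T {f, g} = missed T {g, a}"
    using missed_by_path[OF T R(6,7) full_edge[OF R(2)] full_edge[OF R(4)]] d disj by auto
  moreover have "missed T {g, a} = missed T {a, b}"
    using missed_by_path[OF T R(7,1) full_edge[OF R(3)] full_edge[OF R(5)]] d disj by auto
  ultimately show False by simp
qed

text \<open>Each triangle is also a full set for the other one. Hence \<open>g\<close>, \<open>h\<close> and the opposite triangle
  miss the three vertices of a triangle one by one: \<open>c, b, a\<close> in \<open>T\<close> and \<open>z, y, x\<close> in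
  \<open>U\<close>. Neither \<open>a\<close> nor \<open>x\<close> has a neighbour in the opposite triangle, so the edges
  \<open>{a, v}\<close> and \<open>{x, w}\<close> with \<open>v \<in> {b, c}\<close> and \<open>w \<in> {y, z}\<close> can only be
  joined by \<open>{v, w}\<close>, and \<open>b, c, y, z\<close> induce a \<open>K\<^sub>4\<close>.
  As \<open>g\<close> has a neighbour at \<open>b\<close> and \<open>y\<close>, and \<open>h\<close> at \<open>c\<close> and \<open>z\<close>, the set
  \<open>g \<union> h\<close> is the fifth branch set.\<close>

lemma no_two_triangles_two_edges:
  assumes T: "triangle T" "triangle U" and full: "full g" "full h"
    and disj: "T \<inter> U = {}" "g \<inter> h = {}" "g \<inter> T = {}" "g \<inter> U = {}" "h \<inter> T = {}" "h \<inter> U = {}"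
  shows False
proof -
  have full_triangle: "full S" if S: "triangle S" for S
  proof -
    obtain x y z where "S = {x, y, z}" "x \<noteq> y" "y \<noteq> z"
      using S by (auto simp: triangle_def card_3_iff)
    with S show ?thesis by (auto simp: triangle_def intro!: full_path)
  qed
  obtain c b a where abc: "T = {c, b, a}" "c \<noteq> b" "c \<noteq> a" "b \<noteq> a"
    "missed T g = {c}" "missed T h = {b}" "missed T U = {a}"
    using three_full_sets_miss_triangle[OF T(1) full full_triangle[OF T(2)]] disj by blast
  obtain z y x where xyz: "U = {z, y, x}" "z \<noteq> y" "z \<noteq> x" "y \<noteq> x"
    "missed U g = {z}" "missed U h = {y}" "missed U T = {x}"
    using three_full_sets_miss_triangle[OF T(2) full full_triangle[OF T(1)]] disj by blast
  have cross: "{v, w} \<in> edges G" if "v \<in> {b, c}" "w \<in> {y, z}" for v w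
  proof -
    have "{a, v} \<in> R" "{x, w} \<in> R"
      using that triangle_edge[OF T(1), of a v] triangle_edge[OF T(2), of x w] abc(1-4) xyz(1-4)
      by auto
    moreover have "{a, v} \<inter> {x, w} = {}" using that abc(1) xyz(1) disj(1) by blast
    ultimately have "touch G {a, v} {x, w}" by (intro full_touch full_edge)
    moreover have "\<not> touch G {a} {x}" "\<not> touch G {a} {w}"
      using abc(7) that xyz(1) touch_mono[of G "{a}" _ "{a}" U] touch_sym[of G U "{a}"]
      by (auto simp: missed_def)
    moreover have "\<not> touch G {v} {x}"
      using xyz(7) that abc(1) touch_mono[of G "{v}" "{x}" T "{x}"] by (auto simp: missed_def)
    ultimately show ?thesis by (auto simp: touch_def)
  qed
  have R: "{b, c} \<in> R" "{y, z} \<in> R"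
    using triangle_edge[OF T(1), of b c] triangle_edge[OF T(2), of y z] abc(1-4) xyz(1-4) by auto
  have gh: "touch G g {b}" "touch G h {c}" "touch G g {y}" "touch G h {z}"
    using abc xyz by (auto simp: missed_def)
  have "touch G (g \<union> h) {w}" if "w \<in> {b, c, y, z}" for w
    using gh that by (auto intro: touch_mono)
  then have gh': "touch G {w} (g \<union> h)" if "w \<in> {b, c, y, z}" for w
    using that touch_sym by blast
  have "connected_in G (g \<union> h)"
    using full disj by (intro connected_in_Un) (auto simp: full_touch full_connected_in)
  moreover have "touch G {b} {c}" "touch G {y} {z}"
    using R R_edge by (auto simp: touch_def)
  moreover have "touch G {v} {w}" if "v \<in> {b, c}" "w \<in> {y, z}" for v w
    using cross[OF that] by (auto simp: touch_def)
  ultimately show False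
    using no_five_branch_sets[of "{b}" "{c}" "{y}" "{z}" "g \<union> h"] gh' disj abc(1-4) xyz(1-4)
      R_vertex[OF R(1)] R_vertex[OF R(2)]
    by (auto simp: connected_in_singleton)
qed

text \<open>If \<open>a0\<close> had a neighbour in both parts of the split of the second pentagon into the edge on
  \<open>b4, b0\<close> and the path on \<open>b1, b2, b3\<close>, then these parts, the edges on \<open>a1, a2\<close> and
  \<open>a3, a4\<close>, and \<open>a0\<close> itself would be the branch sets of a \<open>K\<^sub>5\<close>-minor. Up to rotation this
  split separates any two vertices of the second pentagon.\<close>

lemma pentagon_vertex_neighbour_unique:
  assumes a: "cycle_in R [a0, a1, a2, a3, a4]" and b: "cycle_in R [b0, b1, b2, b3, b4]"
    and disj: "{a0, a1, a2, a3, a4} \<inter> {b0, b1, b2, b3, b4} = {}"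
  shows "{a0, b0} \<in> edges G \<Longrightarrow> {a0, b1} \<notin> edges G \<and> {a0, b2} \<notin> edges G"
proof -
  assume e: "{a0, b0} \<in> edges G"
  have R: "{a1, a2} \<in> R" "{a3, a4} \<in> R" "{b4, b0} \<in> R" "{b1, b2} \<in> R" "{b2, b3} \<in> R"
    "{a0, a1} \<in> R" "{a4, a0} \<in> R"
    and d: "distinct [a0, a1, a2, a3, a4, b0, b1, b2, b3, b4]"
    using a b disj by (auto simp: cycle_in_def)
  have "\<not> touch G {a0} {b1, b2, b3}"
  proof
    assume "touch G {a0} {b1, b2, b3}"
    moreover have "touch G {a0} {b4, b0}" using e by (auto simp: touch_def)
    moreover have "touch G {a0} {a1, a2}" "touch G {a0} {a3, a4}"
      using R(6,7) R_edge by (auto simp: touch_def insert_commute)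
    moreover have "full {a1, a2}" "full {a3, a4}" "full {b4, b0}" "full {b1, b2, b3}"
      using R by (auto intro: full_edge full_path)
    ultimately show False
      using no_five_branch_sets[of "{a0}" "{a1, a2}" "{a3, a4}" "{b4, b0}" "{b1, b2, b3}"] d
        R_vertex[OF R(6)]
      by (auto simp: full_connected_in connected_in_singleton full_touch)
  qed
  then show ?thesis by (auto simp: touch_def)
qed

lemma cycle_in_rotate5: "cycle_in R [a, b, c, d, e] \<Longrightarrow> cycle_in R [b, c, d, e, a]"
  by (auto simp: cycle_in_def)

text \<open>The five implications run through all pairs of vertices of the second pentagon.\<close>

lemma pentagon_vertex_neighbours:
  assumes a: "cycle_in R [a0, a1, a2, a3, a4]" and b: "cycle_in R [b0, b1, b2, b3, b4]"
    and disj: "{a0, a1, a2, a3, a4} \<inter> {b0, b1, b2, b3, b4} = {}"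
  defines "N \<equiv> \<lambda>b. {a0, b} \<in> edges G"
  shows "(N b0 \<longrightarrow> \<not> N b1 \<and> \<not> N b2) \<and> (N b1 \<longrightarrow> \<not> N b2 \<and> \<not> N b3) \<and>
    (N b2 \<longrightarrow> \<not> N b3 \<and> \<not> N b4) \<and> (N b3 \<longrightarrow> \<not> N b4 \<and> \<not> N b0) \<and> (N b4 \<longrightarrow> \<not> N b0 \<and> \<not> N b1)"
proof -
  note rot1 = cycle_in_rotate5[OF b]
  note rot2 = cycle_in_rotate5[OF rot1]
  note rot3 = cycle_in_rotate5[OF rot2]
  note rot4 = cycle_in_rotate5[OF rot3]
  have unique: "N u \<longrightarrow> \<not> N v \<and> \<not> N w"
    if "cycle_in R [u, v, w, x, y]" "{u, v, w, x, y} = {b0, b1, b2, b3, b4}" for u v w x y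
    using pentagon_vertex_neighbour_unique[OF a that(1)] disj unfolding that(2) N_def by blast
  show ?thesis
    by (intro conjI unique[OF b] unique[OF rot1] unique[OF rot2] unique[OF rot3] unique[OF rot4]) auto
qed

text \<open>The neighbours of \<open>a0\<close> and \<open>a1\<close> on the second pentagon form a vertex cover of it, because
  \<open>{a0, a1}\<close> touches each of its edges. There are at most two such neighbours, but a vertex cover
  of a pentagon needs three vertices.\<close>

lemma no_two_pentagons:
  assumes a: "cycle_in R [a0, a1, a2, a3, a4]" and b: "cycle_in R [b0, b1, b2, b3, b4]"
    and disj: "{a0, a1, a2, a3, a4} \<inter> {b0, b1, b2, b3, b4} = {}"
  shows False
proof -
  have adj: "{a0, u} \<in> edges G \<or> {a0, v} \<in> edges G \<or> {a1, u} \<in> edges G \<or> {a1, v} \<in> edges G"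
    if "{u, v} \<in> R" "{u, v} \<subseteq> {b0, b1, b2, b3, b4}" for u v
  proof -
    have "{a0, a1} \<inter> {u, v} = {}" using that(2) disj by blast
    moreover have "{a0, a1} \<in> R" using a by (simp add: cycle_in_def)
    ultimately have "touch G {a0, a1} {u, v}" using that(1) by (simp add: full_touch full_edge)
    then show ?thesis by (auto simp: touch_def)
  qed
  have "{b0, b1} \<in> R" "{b1, b2} \<in> R" "{b2, b3} \<in> R" "{b3, b4} \<in> R" "{b4, b0} \<in> R"
    using b by (simp_all add: cycle_in_def)
  from this[THEN adj] have
    "{a0, b0} \<in> edges G \<or> {a0, b1} \<in> edges G \<or> {a1, b0} \<in> edges G \<or> {a1, b1} \<in> edges G"
    "{a0, b1} \<in> edges G \<or> {a0, b2} \<in> edges G \<or> {a1, b1} \<in> edges G \<or> {a1, b2} \<in> edges G"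
    "{a0, b2} \<in> edges G \<or> {a0, b3} \<in> edges G \<or> {a1, b2} \<in> edges G \<or> {a1, b3} \<in> edges G"
    "{a0, b3} \<in> edges G \<or> {a0, b4} \<in> edges G \<or> {a1, b3} \<in> edges G \<or> {a1, b4} \<in> edges G"
    "{a0, b4} \<in> edges G \<or> {a0, b0} \<in> edges G \<or> {a1, b4} \<in> edges G \<or> {a1, b0} \<in> edges G"
    by simp_all
  moreover have disj': "{a1, a2, a3, a4, a0} \<inter> {b0, b1, b2, b3, b4} = {}" using disj by auto
  note pentagon_vertex_neighbours[OF a b disj]
    pentagon_vertex_neighbours[OF cycle_in_rotate5[OF a] b disj']
  ultimately show False by argo
qed

end


section \<open>Reduction to at most two odd cycles\<close>

context K5_free_neighbouring_edges
begin

lemma no_triangle_odd_cycle: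
  assumes pack: "packing R (c # d # ms)" and len: "length c = 3" "odd (length d)"
    and ms: "\<forall>m \<in> set ms. length m = 2" and total: "length c + length d + 2 * length ms = 10"
  shows False
proof -
  have c: "cycle_in R c" and d: "cycle_in R d" and disj: "set c \<inter> set d = {}"
    and pack_ms: "packing R ms"
    and disj_ms: "\<And>m. m \<in> set ms \<Longrightarrow> set m \<inter> set c = {} \<and> set m \<inter> set d = {}"
    using pack by (auto simp: packing_Cons)
  obtain x y z where xyz: "c = [x, y, z]" using len(1) by (auto simp: length_Suc_conv eval_nat_numeral)
  have T: "triangle (set c)" using c triangle_of_cycle[of x y z] by (simp add: xyz)
  have full: "full (set m)" if "m \<in> set ms" for m
  proof -
    have "length m = Suc (Suc 0)" using that ms by simp
    then obtain u v where uv: "m = [u, v]" by (auto simp: length_Suc_conv)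
    with that pack_ms have "{u, v} \<in> R"
      by (auto simp: packing_def cycle_in_def)
    with uv show ?thesis by (simp add: full_edge)
  qed
  have "2 \<le> length d" using d by (simp add: cycle_in_def)
  moreover obtain k where k: "length d = 2 * k + 1" using len(2) by (rule oddE)
  ultimately have "k = 1 \<and> length ms = 2 \<or> k = 2 \<and> length ms = 1 \<or> k = 3 \<and> length ms = 0"
    using len(1) total by arith
  with k consider "length d = 3" "length ms = 2" | "length d = 5" "length ms = 1"
    | "length d = 7" by auto
  then show False
  proof cases
    case 1
    then obtain x' y' z' where d_eq: "d = [x', y', z']" by (auto simp: length_Suc_conv eval_nat_numeral)
    have U: "triangle (set d)" using d triangle_of_cycle[of x' y' z'] by (simp add: d_eq)
    from 1 obtain g h where gh: "ms = [g, h]" by (auto simp: length_Suc_conv eval_nat_numeral)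
    have "set g \<inter> set h = {}" using pack_ms by (simp add: gh packing_Cons)
    then show False
      using no_two_triangles_two_edges[OF T U full[of g] full[of h]] disj disj_ms by (simp add: gh)
  next
    case 2
    then obtain v0 v1 v2 v3 v4 where d_eq: "d = [v0, v1, v2, v3, v4]"
      by (auto simp: length_Suc_conv eval_nat_numeral)
    from 2 obtain g where g: "g \<in> set ms" by (cases ms) auto
    show False
      using no_triangle_pentagon_edge[OF T d[unfolded d_eq] full[OF g]] disj disj_ms[OF g]
      by (auto simp: d_eq)
  next
    case 3
    then obtain v0 v1 v2 v3 v4 v5 v6 where d_eq: "d = [v0, v1, v2, v3, v4, v5, v6]"
      by (auto simp: length_Suc_conv eval_nat_numeral)
    show False
      using no_triangle_heptagon[OF T d[unfolded d_eq]] disj by (auto simp: d_eq)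
  qed
qed

lemma no_two_odd_cycles:
  assumes pack: "packing R (c # d # ms)" and odd: "odd (length c)" "odd (length d)"
    and ms: "\<forall>m \<in> set ms. length m = 2" and total: "10 \<le> length c + length d + 2 * length ms"
  shows False
proof (cases "5 \<le> length c div 2 + length d div 2 + length ms")
  case True
  have "packing R (pairs c @ pairs d @ ms)"
    using pack packing_pairs_of_cycle[of R c] packing_pairs_of_cycle[of R d]
      set_concat_pairs[of c] set_concat_pairs[of d]
    unfolding packing_append packing_Cons concat_append concat.simps set_append by blast
  then show False
    by (rule no_five_edges) (use True ms in \<open>auto simp: length_pairs length_of_mem_pairs\<close>)
next
  case False
  have cyc: "cycle_in R c" "cycle_in R d" and disj: "set c \<inter> set d = {}"
    using pack by (auto simp: packing_Cons)
  then have ge: "2 \<le> length c" "2 \<le> length d" by (auto simp: cycle_in_def)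
  obtain k l where kl: "length c = 2 * k + 1" "length d = 2 * l + 1"
    using odd by (metis oddE)
  \<comment> \<open>Fewer than five edges come out of the ten or more vertices although each cycle loses only one
    of them, so there are exactly ten vertices.\<close>
  have eq: "length c + length d + 2 * length ms = 10"
    using False total kl by simp
  have "k = 1 \<or> l = 1 \<or> k = 2 \<and> l = 2"
    using ge eq kl by arith
  with kl consider "length c = 3" | "length d = 3" | "length c = 5" "length d = 5" by auto
  then show False
  proof cases
    case 1
    with no_triangle_odd_cycle[OF pack _ odd(2) ms eq] show False by simp
  next
    case 2
    have "packing R (d # c # ms)" using pack by (auto simp: packing_Cons)
    from no_triangle_odd_cycle[OF this 2 odd(1) ms] eq show False by simp
  next
    case 3
    obtain a0 a1 a2 a3 a4 where c_eq: "c = [a0, a1, a2, a3, a4]"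
      using 3(1) by (auto simp: length_Suc_conv eval_nat_numeral)
    obtain b0 b1 b2 b3 b4 where d_eq: "d = [b0, b1, b2, b3, b4]"
      using 3(2) by (auto simp: length_Suc_conv eval_nat_numeral)
    show False
      using no_two_pentagons[OF cyc[unfolded c_eq d_eq]] disj by (simp add: c_eq d_eq)
  qed
qed

text \<open>If the number of odd cycles is not \<open>0\<close> or \<open>2\<close>, then one of them can be traded for edges at the
  cost of a single vertex, and at least ten vertices remain: one or three odd cycles together with
  edges have an odd number of vertices, so at least eleven, and four or more odd cycles have
  at least twelve.\<close>

lemma no_odd_cycles_and_edges:
  assumes "packing R (os @ ms)" "\<forall>c \<in> set os. odd (length c)" "\<forall>m \<in> set ms. length m = 2"
    and "10 \<le> length (concat os) + 2 * length ms"
  shows False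
  using assms
proof (induction os arbitrary: ms)
  case Nil
  then show False using no_five_edges[of ms] by simp
next
  case (Cons c os)
  show False
  proof (cases "length os = 1")
    case True
    then obtain d where "os = [d]" by (auto simp: length_Suc_conv)
    with Cons.prems show False using no_two_odd_cycles[of c d ms] by simp
  next
    case False
    have total: "11 \<le> length (concat (c # os)) + 2 * length ms"
    proof (cases "even (length os)")
      case True
      have "odd (length (concat os)) \<longleftrightarrow> odd (length os)"
        if "\<forall>c \<in> set os. odd (length c)" for os :: "'a list list"
        using that by (induction os) auto
      from this[of "c # os"] True Cons.prems(2) have "odd (length (concat (c # os)))" by simp
      with Cons.prems(4) show ?thesis by presburger
    next
      case odd: False
      have "3 * length cs \<le> length (concat cs)" if "\<forall>c \<in> set cs. 3 \<le> length c" for cs :: "'a list list"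
        using that by (induction cs) auto
      moreover have "\<forall>d \<in> set (c # os). 3 \<le> length d"
      proof
        fix d assume d: "d \<in> set (c # os)"
        then have "2 \<le> length d" using Cons.prems(1) by (auto simp: packing_def cycle_in_def)
        moreover have "odd (length d)" using d Cons.prems(2) by blast
        ultimately show "3 \<le> length d" by presburger
      qed
      ultimately have "3 * length (c # os) \<le> length (concat (c # os))" by blast
      moreover have "3 \<le> length os" using odd False by presburger
      ultimately show ?thesis by simp
    qed
    have odd: "odd (length c)" using Cons.prems(2) by simp
    show False
    proof (rule Cons.IH)
      show "packing R (os @ pairs c @ ms)"
        using Cons.prems(1) packing_pairs_of_cycle[of R c] set_concat_pairs[of c]
        unfolding packing_append packing_Cons append_Cons concat_append concat.simps set_append by blast
      show "\<forall>d \<in> set os. odd (length d)" using Cons.prems(2) by simp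
      show "\<forall>m \<in> set (pairs c @ ms). length m = 2"
        using Cons.prems(3) by (auto simp: length_of_mem_pairs)
      show "10 \<le> length (concat os) + 2 * length (pairs c @ ms)"
        using total odd by (auto simp: length_pairs elim!: oddE)
    qed
  qed
qed

lemma packing_covers_less_than_10:
  assumes "packing R cs"
  shows "length (concat cs) < 10"
proof (rule ccontr)
  assume "\<not> ?thesis"
  moreover obtain os ms where "packing R (os @ ms)" "\<forall>c \<in> set os. odd (length c)" and
    ms: "\<forall>m \<in> set ms. length m = 2" and "length (concat (os @ ms)) = length (concat cs)"
    using packing_odd_cycles_and_edges[OF assms] by blast
  moreover have "length (concat ms) = 2 * length ms" using ms by (induction ms) auto
  ultimately show False using no_odd_cycles_and_edges[of os ms] by simp
qed


section \<open>Duality with vertex covers\<close>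

text \<open>The edges of the bipartite double cover of the graph with edge set \<open>R\<close>. A cover of this relation
  is twice a half-integral fractional vertex cover.\<close>

definition arcs :: "('a \<times> 'a) set" where
  "arcs = {(u, v). {u, v} \<in> R}"

lemma finite_R: "finite R"
  using finite_edges R_edge by (meson finite_subset subsetI)

lemma finite_arcs: "finite arcs"
  by (rule finite_subset[OF _ finite_cartesian_product[OF finite_verts finite_verts]])
    (auto simp: arcs_def dest: R_vertex)

lemma small_cover_exists: "\<exists>A B. rel_cover arcs A B \<and> card A + card B \<le> 9"
proof (rule ccontr)
  assume "\<not> ?thesis"
  then have "10 \<le> card A + card B" if "rel_cover arcs A B" for A B
    using that by fastforce
  from koenig[OF finite_arcs this] obtain M
    where M: "M \<subseteq> arcs" "inj_on fst M" "inj_on snd M" "10 \<le> card M" by blast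
  have "finite M" using M(1) finite_arcs by (rule finite_subset)
  moreover have "{u, v} \<in> R \<and> u \<noteq> v" if "(u, v) \<in> M" for u v
    using that M(1) R_neq by (auto simp: arcs_def)
  ultimately obtain cs where "packing R cs" "card M \<le> length (concat cs)"
    using packing_of_partial_injection M(2,3) by metis
  with M(4) packing_covers_less_than_10 show False by fastforce
qed

text \<open>Double counting: the left-hand side adds up the weights at the vertices of \<open>A\<close>, each of which is
  at most \<open>1\<close>.\<close>

lemma fractional_matching_weight_on_cover:
  assumes g: "fractional_matching (edge_induced_subgraph R) g" and "finite A"
  shows "(\<Sum>e \<in> R. g e * card (e \<inter> A)) \<le> card A"
proof -
  have "(\<Sum>e \<in> R. g e * card (e \<inter> A)) = (\<Sum>e \<in> R. \<Sum>v \<in> A. if v \<in> e then g e else 0)"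
  proof (rule sum.cong)
    fix e assume "e \<in> R"
    have "(\<Sum>v \<in> A. if v \<in> e then g e else 0) = (\<Sum>v \<in> A \<inter> e. g e)"
      using sum.inter_restrict[OF \<open>finite A\<close>, of "\<lambda>_. g e" e] by simp
    then show "g e * card (e \<inter> A) = (\<Sum>v \<in> A. if v \<in> e then g e else 0)"
      by (simp add: Int_commute mult.commute)
  qed simp
  also have "\<dots> = (\<Sum>v \<in> A. \<Sum>e \<in> R. if v \<in> e then g e else 0)"
    by (rule sum.swap)
  also have "\<dots> = (\<Sum>v \<in> A. \<Sum>e \<in> {e \<in> R. v \<in> e}. g e)"
    using finite_R by (simp add: sum.inter_filter)
  also have "\<dots> \<le> (\<Sum>v \<in> A. 1)"
  proof (rule sum_mono)
    fix v
    show "(\<Sum>e \<in> {e \<in> R. v \<in> e}. g e) \<le> 1"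
    proof (cases "v \<in> \<Union>R")
      case True
      then show ?thesis using g by (auto simp: fractional_matching_def edge_induced_subgraph_def)
    next
      case False
      then have "{e \<in> R. v \<in> e} = {}" by blast
      then show ?thesis by (simp only: sum.empty)
    qed
  qed
  finally show ?thesis by simp
qed

text \<open>Weak duality. An edge \<open>{u, v}\<close> gives two arcs, and each of them is covered, so every edge has at
  least two incidences with \<open>A\<close> and \<open>B\<close> together.\<close>

lemma fractional_matching_value_le:
  assumes g: "fractional_matching (edge_induced_subgraph R) g"
  shows "fractional_matching_value (edge_induced_subgraph R) g \<le> 9 / 2"
proof -
  obtain A B where AB: "rel_cover arcs A B" "card A + card B \<le> 9"
    using small_cover_exists by blast
  then have fin: "finite A" "finite B" by (auto simp: rel_cover_def)
  have "(\<Sum>e \<in> R. g e * 2) \<le> (\<Sum>e \<in> R. g e * card (e \<inter> A) + g e * card (e \<inter> B))"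
  proof (rule sum_mono)
    fix e assume e: "e \<in> R"
    obtain u v where uv: "e = {u, v}" "u \<noteq> v"
      using card_edge[OF R_edge[OF e]] by (auto simp: card_2_iff)
    have "{v, u} \<in> R" using e uv by (simp add: insert_commute)
    then have "u \<in> A \<or> v \<in> B" "v \<in> A \<or> u \<in> B"
      using AB(1) e uv(1) by (auto simp: rel_cover_def arcs_def)
    then have "2 \<le> card (e \<inter> A) + card (e \<inter> B)"
      using uv by (auto simp: Int_insert_left)
    then have "(2::real) \<le> card (e \<inter> A) + card (e \<inter> B)" by linarith
    moreover have "0 \<le> g e"
      using g e by (simp add: fractional_matching_def edge_induced_subgraph_def)
    ultimately have "g e * 2 \<le> g e * (card (e \<inter> A) + card (e \<inter> B))"
      by (intro mult_left_mono) auto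
    then show "g e * 2 \<le> g e * card (e \<inter> A) + g e * card (e \<inter> B)"
      by (simp add: distrib_left)
  qed
  also have "\<dots> \<le> real (card A) + real (card B)"
    using fractional_matching_weight_on_cover[OF g] fin by (simp add: sum.distrib add_mono)
  also have "\<dots> \<le> 9" using AB(2) by linarith
  finally show ?thesis
    by (simp add: fractional_matching_value_def edge_induced_subgraph_def flip: sum_distrib_right)
qed

end

theorem theorem1p3:
  fixes G :: "'a ugraph" and R :: "'a set set"
  assumes "simple_graph G"
    and "\<not> is_minor (complete_graph 5) G"
    and "neighbouring_set G R"
  shows "fractional_matching_number (edge_induced_subgraph R) \<le> 9 / 2"
proof -
  interpret simple_graph G by fact
  interpret K5_free_neighbouring_edges G R
    by unfold_locales (fact assms)+
  show ?thesis
    unfolding fractional_matching_number_def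
    using fractional_matching_zero fractional_matching_value_le by (intro cSUP_least) auto
qed

end
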